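(* Let $G$ be a finite simple graph containing a vertex of degree one, let $K$ be a field, and let $\mathcal{A}=K[x_v : v\in V(G)]$. Then the closed neighborhood ideal $CNI(G)\subseteq\mathcal{A}$ admits a strongly superficial element of degree $1$. In particular, $CNI(G)$ satisfies the strong persistence property.
   Context: For a vertex $y$ of $G$, the closed neighborhood is $N[y]=\{y\}\cup\{z\in V(G): \{y,z\}\in E(G)\}$. The closed neighborhood ideal of $G$ is the monomial ideal $$CNI(G)=\left(\prod_{z\in N[y]}x_z \;:\; y\in V(G)\right)\subseteq \mathcal{A}.$$ For a monomial ideal $I\subseteq\mathcal{A}$, a strongly superficial element of degree $1$ of $I$ is an element $m\in I$ (that is, $m\in I^1$; "degree $1$" refers to the power of $I$, not to the polynomial degree of $m$) such that $(I^{k+1}:_{\mathcal{A}} m)=I^k$ for every integer $k\ge 1$. The ideal $I$ satisfies the strong persistence property if $(I^{k+1}:_{\mathcal{A}} I)=I^k$ for all $k\ge 1$. *)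

theory Defs
  imports
    "HOL-Library.Poly_Mapping"
    "HOL-Algebra.Ideal_Product"
    "Graph_Theory.Pair_Digraph"
begin

text \<open>
  A finite simple graph is a \<open>pair_graph\<close>: a finite, loop-free, symmetric set of ordered pairs, in
  which an edge $\{y,z\}$ is represented by the two arcs $(y,z)$ and $(z,y)$. Accordingly the degree
  of a vertex is its \<open>out_degree\<close>, the number of neighbours.
\<close>

definition closed_nbhd :: "'v pair_pre_digraph \<Rightarrow> 'v \<Rightarrow> 'v set" where
  "closed_nbhd G y = {y} \<union> {z \<in> pverts G. (y, z) \<in> parcs G}"

text \<open>
  A polynomial is a finitely supported map from exponent vectors to coefficients. The carrier
  consists of the polynomials in which only variables indexed by \<open>V\<close> occur, so that ideals and
  colon ideals are taken in $K[x_v : v \in V]$ even when \<open>V\<close> is not the whole type.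
\<close>

definition polynomial_ring :: "'v set \<Rightarrow> (('v \<Rightarrow>\<^sub>0 nat) \<Rightarrow>\<^sub>0 'k::field) ring" where
  "polynomial_ring V =
    \<lparr>carrier = {p. \<forall>t \<in> Poly_Mapping.keys p. Poly_Mapping.keys t \<subseteq> V},
     monoid.mult = (*), one = 1, zero = 0, add = (+)\<rparr>"

definition var :: "'v \<Rightarrow> (('v \<Rightarrow>\<^sub>0 nat) \<Rightarrow>\<^sub>0 'k::field)" where
  "var v = Poly_Mapping.single (Poly_Mapping.single v 1) 1"

definition CNI :: "'v pair_pre_digraph \<Rightarrow> (('v \<Rightarrow>\<^sub>0 nat) \<Rightarrow>\<^sub>0 'k::field) set" where
  "CNI G = Idl\<^bsub>polynomial_ring (pverts G)\<^esub> {\<Prod>z\<in>closed_nbhd G y. var z | y. y \<in> pverts G}"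

definition ideal_power :: "('a, 'b) ring_scheme \<Rightarrow> 'a set \<Rightarrow> nat \<Rightarrow> 'a set" where
  "ideal_power R I k = I [^]\<^bsub>ideals_set R\<^esub> k"

definition colon :: "('a, 'b) ring_scheme \<Rightarrow> 'a set \<Rightarrow> 'a set \<Rightarrow> 'a set" where
  "colon R I S = {r \<in> carrier R. \<forall>s \<in> S. r \<otimes>\<^bsub>R\<^esub> s \<in> I}"

definition strongly_superficial_deg1 :: "('a, 'b) ring_scheme \<Rightarrow> 'a set \<Rightarrow> 'a \<Rightarrow> bool" where
  "strongly_superficial_deg1 R I m \<longleftrightarrow>
    m \<in> I \<and> (\<forall>k\<ge>1. colon R (ideal_power R I (k + 1)) {m} = ideal_power R I k)"

definition strong_persistence :: "('a, 'b) ring_scheme \<Rightarrow> 'a set \<Rightarrow> bool" where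
  "strong_persistence R I \<longleftrightarrow>
    (\<forall>k\<ge>1. colon R (ideal_power R I (k + 1)) I = ideal_power R I k)"

lemma cring_polynomial_ring:
  "cring (polynomial_ring V :: (('v \<Rightarrow>\<^sub>0 nat) \<Rightarrow>\<^sub>0 'k::field) ring)" (is "cring ?R")
proof (rule cringI)
  show "abelian_group ?R"
  proof (rule abelian_groupI)
    fix p q assume "p \<in> carrier ?R" "q \<in> carrier ?R"
    then show "p \<oplus>\<^bsub>?R\<^esub> q \<in> carrier ?R"
      using Poly_Mapping.keys_add[of p q] by (auto simp: polynomial_ring_def)
  next
    fix p assume "p \<in> carrier ?R"
    then show "\<exists>q\<in>carrier ?R.
        q \<oplus>\<^bsub>?R\<^esub> p = \<zero>\<^bsub>?R\<^esub>"
      by (intro bexI[of _ "- p"]) (auto simp: polynomial_ring_def)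
  qed (auto simp: polynomial_ring_def add.assoc add.commute)
  show "comm_monoid ?R"
  proof (rule comm_monoidI)
    fix p q assume pq: "p \<in> carrier ?R" "q \<in> carrier ?R"
    show "p \<otimes>\<^bsub>?R\<^esub> q \<in> carrier ?R"
      unfolding polynomial_ring_def
    proof (simp, rule ballI)
      fix t assume "t \<in> Poly_Mapping.keys (p * q)"
      then obtain a b where "t = a + b" "a \<in> Poly_Mapping.keys p" "b \<in> Poly_Mapping.keys q"
        using Poly_Mapping.keys_mult[of p q] by blast
      then show "Poly_Mapping.keys t \<subseteq> V"
        using pq Poly_Mapping.keys_add[of a b] by (fastforce simp: polynomial_ring_def)
    qed
  qed (auto simp: polynomial_ring_def mult.assoc mult.commute)
qed (auto simp: polynomial_ring_def distrib_right)

end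

theory Submission
  imports Defs
begin

text \<open>
  Let $v$ be a vertex of degree one and $w$ its neighbour. The witness is $m = x_v x_w$, which is the
  generator of $CNI(G)$ attached to $N[v]$. The variable $x_v$ occurs in just two generators, those
  of $N[v]$ and $N[w]$, and $m$ divides both. So every generator divisible by $x_v$ is divisible
  by $m$, and this property alone makes $m$ superficial.

  To see this, let $u$ be a monomial with $um = g_1 \cdots g_{k+1} h$, where the $g_i$ are generators.
  If $x_v$ divides some $g_i$, then $m$ divides $g_i$, and cancelling $m$ leaves $u$ as a multiple of
  the other $k$ generators. Otherwise $x_v$ has to be cancelled against $h$, and $x_w$ is cancelled
  against $h$ or against one of the $g_i$. This spoils at most one of the $k+1$ generators, so at
  least $k$ of them still divide $u$ (\<open>superficial_exponents\<close>).

  The passage from monomials to polynomials rests on the fact that membership in a monomial ideal is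
  decided term by term. Products of monomial ideals are generated by the sums of the exponents
  (\<open>ideal_prod_monomial_ideal\<close>), hence the powers of $CNI(G)$ are again monomial, and multiplication
  by the monomial $m$ merely translates exponents. Strong persistence is then formal:
  $I^k \subseteq (I^{k+1} : I) \subseteq (I^{k+1} : m) = I^k$.
\<close>

section \<open>Translation of exponents\<close>

lemma sum_single_lookup:
  "(\<Sum>t\<in>Poly_Mapping.keys p. Poly_Mapping.single t (Poly_Mapping.lookup p t)) = p"
proof (rule poly_mapping_eqI)
  fix s
  show "Poly_Mapping.lookup (\<Sum>t\<in>Poly_Mapping.keys p.
          Poly_Mapping.single t (Poly_Mapping.lookup p t)) s = Poly_Mapping.lookup p s"
    by (simp add: lookup_sum lookup_single when_def in_keys_iff)
qed

lemma lookup_times_monomial: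
  fixes p :: "('a::cancel_comm_monoid_add) \<Rightarrow>\<^sub>0 ('k::comm_semiring_1)"
  shows "Poly_Mapping.lookup (p * Poly_Mapping.single m 1) (t + m) = Poly_Mapping.lookup p t"
proof -
  have "p * Poly_Mapping.single m 1 =
      (\<Sum>s\<in>Poly_Mapping.keys p. Poly_Mapping.single s (Poly_Mapping.lookup p s))
        * Poly_Mapping.single m 1"
    by (simp add: sum_single_lookup)
  also have "\<dots> =
      (\<Sum>s\<in>Poly_Mapping.keys p. Poly_Mapping.single (s + m) (Poly_Mapping.lookup p s))"
    by (simp add: sum_distrib_right mult_single)
  finally show ?thesis
    by (simp add: lookup_sum lookup_single when_def in_keys_iff)
qed

lemma keys_plus_nat:
  fixes s t :: "'v \<Rightarrow>\<^sub>0 nat"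
  shows "Poly_Mapping.keys (s + t) = Poly_Mapping.keys s \<union> Poly_Mapping.keys t"
  by (auto simp: in_keys_iff lookup_add)

lemma split_off_variable:
  fixes t :: "'v \<Rightarrow>\<^sub>0 nat"
  assumes "Poly_Mapping.lookup t v > 0"
  obtains s where "t = Poly_Mapping.single v 1 + s"
proof
  show "t = Poly_Mapping.single v 1 + (t - Poly_Mapping.single v 1)"
    using assms
    by (intro poly_mapping_eqI) (auto simp: lookup_add lookup_minus lookup_single when_def)
qed

section \<open>Monomial ideals\<close>

text \<open>
  Divisibility of monomials is written additively, as \<open>t = a + s\<close>. Defining the ideal by a condition
  on each term, rather than as a span, is what makes products and colons computable on exponents.
\<close>

definition monomial_ideal ::
    "'v set \<Rightarrow> ('v \<Rightarrow>\<^sub>0 nat) set \<Rightarrow> (('v \<Rightarrow>\<^sub>0 nat) \<Rightarrow>\<^sub>0 'k::field) set" where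
  "monomial_ideal V A =
    {p. \<forall>t\<in>Poly_Mapping.keys p. Poly_Mapping.keys t \<subseteq> V \<and> (\<exists>a\<in>A. \<exists>s. t = a + s)}"

lemma monomial_ideal_subset_carrier:
  "monomial_ideal V A \<subseteq> carrier (polynomial_ring V)"
  by (auto simp: monomial_ideal_def polynomial_ring_def)

lemma add_in_monomial_ideal:
  "p \<in> monomial_ideal V A \<Longrightarrow> q \<in> monomial_ideal V A \<Longrightarrow> p + q \<in> monomial_ideal V A"
  using Poly_Mapping.keys_add[of p q] unfolding monomial_ideal_def by blast

lemma single_in_monomial_ideal:
  assumes "a \<in> A" "Poly_Mapping.keys a \<subseteq> V"
  shows "Poly_Mapping.single a c \<in> monomial_ideal V A"
proof -
  have "\<exists>b\<in>A. \<exists>s. a = b + s"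
    using assms(1) by (intro bexI[of _ a] exI[of _ 0]) auto
  with assms(2) show ?thesis
    by (simp add: monomial_ideal_def)
qed

lemma times_in_monomial_ideal:
  assumes p: "p \<in> monomial_ideal V A" and q: "q \<in> monomial_ideal V B"
  shows "p * q \<in> monomial_ideal V {a + b | a b. a \<in> A \<and> b \<in> B}"
  unfolding monomial_ideal_def
proof (intro CollectI ballI)
  fix t assume "t \<in> Poly_Mapping.keys (p * q)"
  then obtain t1 t2 where t: "t = t1 + t2"
      and "t1 \<in> Poly_Mapping.keys p" "t2 \<in> Poly_Mapping.keys q"
    using Poly_Mapping.keys_mult[of p q] by blast
  then obtain a s b r where "a \<in> A" "t1 = a + s" "b \<in> B" "t2 = b + r"
      and V: "Poly_Mapping.keys t1 \<subseteq> V" "Poly_Mapping.keys t2 \<subseteq> V"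
    using p q unfolding monomial_ideal_def by blast
  then have "t = (a + b) + (s + r)" "a + b \<in> {a + b | a b. a \<in> A \<and> b \<in> B}"
    using t by (auto simp: algebra_simps)
  moreover have "Poly_Mapping.keys t \<subseteq> V"
    using V t by (simp add: keys_plus_nat)
  ultimately show "Poly_Mapping.keys t \<subseteq> V \<and>
      (\<exists>c\<in>{a + b | a b. a \<in> A \<and> b \<in> B}. \<exists>s. t = c + s)"
    by blast
qed

lemma monomial_ideal_zero: "monomial_ideal V {0} = carrier (polynomial_ring V)"
  by (auto simp: monomial_ideal_def polynomial_ring_def)

lemma ideal_monomial_ideal:
  "ideal (monomial_ideal V A :: (('v \<Rightarrow>\<^sub>0 nat) \<Rightarrow>\<^sub>0 'k::field) set) (polynomial_ring V)"
    (is "ideal ?M ?R")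
proof -
  interpret R: cring ?R by (rule cring_polynomial_ring)
  have absorb: "p * q \<in> ?M" if "p \<in> ?M" "q \<in> carrier ?R" for p q
    using times_in_monomial_ideal[OF that(1), of q "{0}"] that(2)
    by (simp add: monomial_ideal_zero)
  show ?thesis
  proof (rule idealI)
    show "ring ?R" by (rule R.ring_axioms)
    show "subgroup ?M (add_monoid ?R)"
    proof (rule R.add.subgroupI)
      show "?M \<subseteq> carrier ?R" by (rule monomial_ideal_subset_carrier)
      have "0 \<in> ?M" by (simp add: monomial_ideal_def)
      then show "?M \<noteq> {}" by blast
    next
      fix p assume p: "p \<in> ?M"
      have "- p \<in> ?M" using p by (simp add: monomial_ideal_def)
      moreover have "\<ominus>\<^bsub>?R\<^esub> p = - p"
        using p \<open>- p \<in> ?M\<close> monomial_ideal_subset_carrier[of V A]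
        by (intro R.minus_equality) (auto simp: polynomial_ring_def)
      ultimately show "\<ominus>\<^bsub>?R\<^esub> p \<in> ?M" by simp
    next
      fix p q assume "p \<in> ?M" "q \<in> ?M"
      then show "p \<oplus>\<^bsub>?R\<^esub> q \<in> ?M"
        using add_in_monomial_ideal by (auto simp: polynomial_ring_def)
    qed
  next
    fix p q assume "p \<in> ?M" "q \<in> carrier ?R"
    then have "p * q \<in> ?M" by (rule absorb)
    then show "q \<otimes>\<^bsub>?R\<^esub> p \<in> ?M" "p \<otimes>\<^bsub>?R\<^esub> q \<in> ?M"
      by (simp_all add: polynomial_ring_def mult.commute)
  qed
qed

text \<open>
  A set closed under addition contains a polynomial as soon as it contains its terms, so only
  single terms have to be produced when an ideal is shown to contain a monomial ideal.
\<close>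

lemma monomial_ideal_subsetI:
  fixes J :: "(('v \<Rightarrow>\<^sub>0 nat) \<Rightarrow>\<^sub>0 'k::field) set"
  assumes zero: "0 \<in> J"
    and add: "\<And>p q. p \<in> J \<Longrightarrow> q \<in> J \<Longrightarrow> p + q \<in> J"
    and terms: "\<And>a s c. a \<in> A \<Longrightarrow> Poly_Mapping.keys a \<subseteq> V \<Longrightarrow> Poly_Mapping.keys s \<subseteq> V
                  \<Longrightarrow> Poly_Mapping.single (a + s) c \<in> J"
  shows "monomial_ideal V A \<subseteq> J"
proof
  fix p :: "('v \<Rightarrow>\<^sub>0 nat) \<Rightarrow>\<^sub>0 'k" assume p: "p \<in> monomial_ideal V A"
  have sums: "sum f T \<in> J" if "finite T" "\<forall>t\<in>T. f t \<in> J" for T and f :: "('v \<Rightarrow>\<^sub>0 nat) \<Rightarrow> _"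
    using that by (induction T) (auto intro: zero add)
  have "Poly_Mapping.single t (Poly_Mapping.lookup p t) \<in> J" if t: "t \<in> Poly_Mapping.keys p" for t
  proof -
    obtain a s where "a \<in> A" "t = a + s" "Poly_Mapping.keys t \<subseteq> V"
      using p t unfolding monomial_ideal_def by blast
    then show ?thesis using terms by (auto simp: keys_plus_nat)
  qed
  then have "(\<Sum>t\<in>Poly_Mapping.keys p. Poly_Mapping.single t (Poly_Mapping.lookup p t)) \<in> J"
    by (intro sums) auto
  then show "p \<in> J" by (simp add: sum_single_lookup)
qed

lemma genideal_monomials:
  assumes "\<And>a. a \<in> A \<Longrightarrow> Poly_Mapping.keys a \<subseteq> V"
  shows "Idl\<^bsub>polynomial_ring V\<^esub> ((\<lambda>a. Poly_Mapping.single a 1) ` A)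
      = (monomial_ideal V A :: (('v \<Rightarrow>\<^sub>0 nat) \<Rightarrow>\<^sub>0 'k::field) set)"
    (is "Idl\<^bsub>?R\<^esub> ?S = ?M")
proof
  interpret R: cring ?R by (rule cring_polynomial_ring)
  have S: "?S \<subseteq> ?M" using assms by (auto intro: single_in_monomial_ideal)
  show "Idl\<^bsub>?R\<^esub> ?S \<subseteq> ?M"
    by (rule R.genideal_minimal[OF ideal_monomial_ideal S])
  have "?S \<subseteq> carrier ?R" using S monomial_ideal_subset_carrier by blast
  then interpret I: ideal "Idl\<^bsub>?R\<^esub> ?S" ?R by (rule R.genideal_ideal)
  have gens: "?S \<subseteq> Idl\<^bsub>?R\<^esub> ?S" by (rule R.genideal_self) fact
  show "?M \<subseteq> Idl\<^bsub>?R\<^esub> ?S"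
  proof (rule monomial_ideal_subsetI)
    show "0 \<in> Idl\<^bsub>?R\<^esub> ?S"
      using I.zero_closed by (simp add: polynomial_ring_def)
    show "p + q \<in> Idl\<^bsub>?R\<^esub> ?S" if "p \<in> Idl\<^bsub>?R\<^esub> ?S" "q \<in> Idl\<^bsub>?R\<^esub> ?S" for p q
      using I.a_closed[OF that] by (simp add: polynomial_ring_def)
    fix a s :: "'v \<Rightarrow>\<^sub>0 nat" and c :: 'k
    assume "a \<in> A" and s: "Poly_Mapping.keys s \<subseteq> V"
    then have "Poly_Mapping.single a 1 \<in> Idl\<^bsub>?R\<^esub> ?S" using gens by blast
    moreover have "Poly_Mapping.single s c \<in> carrier ?R"
      using s by (simp add: polynomial_ring_def)
    ultimately have "Poly_Mapping.single a 1 \<otimes>\<^bsub>?R\<^esub> Poly_Mapping.single s c \<in> Idl\<^bsub>?R\<^esub> ?S"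
      by (rule I.I_r_closed)
    then show "Poly_Mapping.single (a + s) c \<in> Idl\<^bsub>?R\<^esub> ?S"
      by (simp add: polynomial_ring_def mult_single)
  qed
qed

lemma ideal_prod_monomial_ideal:
  "ideal_prod (polynomial_ring V) (monomial_ideal V A) (monomial_ideal V B)
    = (monomial_ideal V {a + b | a b. a \<in> A \<and> b \<in> B} :: (('v \<Rightarrow>\<^sub>0 nat) \<Rightarrow>\<^sub>0 'k::field) set)"
    (is "ideal_prod ?R ?M ?N = ?P")
proof
  show "ideal_prod ?R ?M ?N \<subseteq> ?P"
  proof
    fix p assume "p \<in> ideal_prod ?R ?M ?N"
    then show "p \<in> ?P"
    proof (induction rule: ideal_prod.induct)
      case (prod i j)
      then show ?case using times_in_monomial_ideal by (simp add: polynomial_ring_def)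
    next
      case (sum p q)
      then show ?case using add_in_monomial_ideal by (simp add: polynomial_ring_def)
    qed
  qed
  have times: "i * j \<in> ideal_prod ?R ?M ?N" if "i \<in> ?M" "j \<in> ?N" for i j
    using ideal_prod.prod[OF that, of ?R] by (simp add: polynomial_ring_def)
  show "?P \<subseteq> ideal_prod ?R ?M ?N"
  proof (rule monomial_ideal_subsetI)
    have "0 \<in> ?M" "0 \<in> ?N" by (simp_all add: monomial_ideal_def)
    from times[OF this] show "0 \<in> ideal_prod ?R ?M ?N" by simp
    show "p + q \<in> ideal_prod ?R ?M ?N"
      if "p \<in> ideal_prod ?R ?M ?N" "q \<in> ideal_prod ?R ?M ?N" for p q
      using ideal_prod.sum[OF that] by (simp add: polynomial_ring_def)
    fix t s :: "'v \<Rightarrow>\<^sub>0 nat" and c :: 'k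
    assume "t \<in> {a + b | a b. a \<in> A \<and> b \<in> B}" "Poly_Mapping.keys t \<subseteq> V"
      and s: "Poly_Mapping.keys s \<subseteq> V"
    then obtain a b where t: "t = a + b" and "a \<in> A" "b \<in> B"
        and V: "Poly_Mapping.keys a \<subseteq> V" "Poly_Mapping.keys b \<subseteq> V"
      by (auto simp: keys_plus_nat)
    have "Poly_Mapping.single (b + s) c \<in> ?N"
      using \<open>b \<in> B\<close> V s by (auto simp: monomial_ideal_def keys_plus_nat)
    moreover have "Poly_Mapping.single a 1 \<in> ?M"
      using \<open>a \<in> A\<close> V by (intro single_in_monomial_ideal)
    ultimately have
      "Poly_Mapping.single a 1 * Poly_Mapping.single (b + s) c \<in> ideal_prod ?R ?M ?N"
      by (rule times[rotated])
    then show "Poly_Mapping.single (t + s) c \<in> ideal_prod ?R ?M ?N"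
      by (simp add: mult_single t add.assoc)
  qed
qed

section \<open>Powers of monomial ideals\<close>

text \<open>
  Multisets keep track of which generators are multiplied, so that a single one can be removed when
  a variable is cancelled.
\<close>

definition fold_sums :: "nat \<Rightarrow> 'a::comm_monoid_add set \<Rightarrow> 'a set" where
  "fold_sums k A = {\<Sum>\<^sub># M | M. set_mset M \<subseteq> A \<and> size M = k}"

lemma fold_sums_0: "fold_sums 0 A = {0}"
  by (auto simp: fold_sums_def)

lemma fold_sums_Suc: "fold_sums (Suc k) A = {s + a | s a. s \<in> fold_sums k A \<and> a \<in> A}"
proof (intro equalityI subsetI)
  fix t assume "t \<in> fold_sums (Suc k) A"
  then obtain M where "t = \<Sum>\<^sub># M" "set_mset M \<subseteq> A" "size M = Suc k"
    by (auto simp: fold_sums_def)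
  moreover then obtain a N where "M = add_mset a N"
    by (metis size_eq_Suc_imp_eq_union)
  ultimately have "t = \<Sum>\<^sub># N + a" "\<Sum>\<^sub># N \<in> fold_sums k A" "a \<in> A"
    by (auto simp: fold_sums_def add.commute)
  then show "t \<in> {s + a | s a. s \<in> fold_sums k A \<and> a \<in> A}" by blast
next
  fix t assume "t \<in> {s + a | s a. s \<in> fold_sums k A \<and> a \<in> A}"
  then obtain M a where "t = \<Sum>\<^sub># M + a" "set_mset M \<subseteq> A" "size M = k" "a \<in> A"
    by (auto simp: fold_sums_def)
  then show "t \<in> fold_sums (Suc k) A"
    unfolding fold_sums_def by (intro CollectI exI[of _ "add_mset a M"]) (simp add: add.commute)
qed

lemma ideal_power_Suc: "ideal_power R I (Suc k) = ideal_prod R (ideal_power R I k) I"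
  by (simp add: ideal_power_def nat_pow_def ideals_set_def)

lemma ideal_power_monomial_ideal:
  "ideal_power (polynomial_ring V) (monomial_ideal V A) k
    = (monomial_ideal V (fold_sums k A) :: (('v \<Rightarrow>\<^sub>0 nat) \<Rightarrow>\<^sub>0 'k::field) set)"
proof (induction k)
  case 0
  show ?case
    by (simp add: ideal_power_def nat_pow_def ideals_set_def fold_sums_0 monomial_ideal_zero)
next
  case (Suc k)
  then show ?case
    by (simp add: ideal_power_Suc ideal_prod_monomial_ideal fold_sums_Suc)
qed

section \<open>Superficial monomials\<close>

text \<open>
  The cancellation argument: \<open>h\<close> absorbs the variable \<open>v\<close> unless some generator contains it, and
  such a generator absorbs the whole monomial at once. In either case at most one of the \<open>k + 1\<close>
  generators is lost.
\<close>

lemma superficial_exponents: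
  fixes A :: "('v \<Rightarrow>\<^sub>0 nat) set" and v w :: 'v
  defines "m \<equiv> Poly_Mapping.single v 1 + Poly_Mapping.single w 1"
  assumes gens: "\<And>a. a \<in> A \<Longrightarrow> Poly_Mapping.lookup a v > 0 \<Longrightarrow> \<exists>s. a = m + s"
    and t: "t + m = g + h" "g \<in> fold_sums (Suc k) A"
  shows "\<exists>g'\<in>fold_sums k A. \<exists>s. t = g' + s"
proof -
  obtain M where M: "g = \<Sum>\<^sub># M" "set_mset M \<subseteq> A" "size M = Suc k"
    using t(2) by (auto simp: fold_sums_def)
  have removal: "\<exists>N. M = add_mset a N \<and> \<Sum>\<^sub># N \<in> fold_sums k A" if a: "a \<in># M" for a
  proof -
    obtain N where N: "M = add_mset a N" using a by (metis mset_add)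
    then show ?thesis using M(2,3) by (auto simp: fold_sums_def)
  qed
  show ?thesis
  proof (cases "\<exists>a\<in>#M. Poly_Mapping.lookup a v > 0")
    case True
    then obtain a where a: "a \<in># M" "Poly_Mapping.lookup a v > 0" by blast
    with M(2) obtain s where s: "a = m + s" using gens by blast
    obtain N where N: "M = add_mset a N" "\<Sum>\<^sub># N \<in> fold_sums k A"
      using removal[OF a(1)] by blast
    have "t + m = (\<Sum>\<^sub># N + (s + h)) + m"
      using t(1) M(1) N(1) s by (simp add: algebra_simps)
    then have "t = \<Sum>\<^sub># N + (s + h)" by (rule add_right_imp_eq)
    with N(2) show ?thesis by blast
  next
    case False
    then have "Poly_Mapping.lookup (\<Sum>\<^sub># M) v = 0"
      by (induction M) (auto simp: lookup_add)
    moreover have "Poly_Mapping.lookup (t + m) v > 0"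
      by (simp add: m_def lookup_add)
    ultimately have "Poly_Mapping.lookup h v > 0"
      using t(1) M(1) by (simp add: lookup_add)
    then obtain h' where "h = Poly_Mapping.single v 1 + h'" by (rule split_off_variable)
    then have "(t + Poly_Mapping.single w 1) + Poly_Mapping.single v 1
        = (g + h') + Poly_Mapping.single v 1"
      using t(1) by (simp add: m_def algebra_simps)
    then have w: "t + Poly_Mapping.single w 1 = g + h'" by (rule add_right_imp_eq)
    show ?thesis
    proof (cases "\<exists>a\<in>#M. Poly_Mapping.lookup a w > 0")
      case True
      then obtain a where a: "a \<in># M" "Poly_Mapping.lookup a w > 0" by blast
      from a(2) obtain s where s: "a = Poly_Mapping.single w 1 + s" by (rule split_off_variable)
      obtain N where N: "M = add_mset a N" "\<Sum>\<^sub># N \<in> fold_sums k A"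
        using removal[OF a(1)] by blast
      have "t + Poly_Mapping.single w 1 = (\<Sum>\<^sub># N + (s + h')) + Poly_Mapping.single w 1"
        using w M(1) N(1) s by (simp add: algebra_simps)
      then have "t = \<Sum>\<^sub># N + (s + h')" by (rule add_right_imp_eq)
      with N(2) show ?thesis by blast
    next
      case False
      then have "Poly_Mapping.lookup (\<Sum>\<^sub># M) w = 0"
        by (induction M) (auto simp: lookup_add)
      moreover have "Poly_Mapping.lookup (t + Poly_Mapping.single w 1) w > 0"
        by (simp add: lookup_add)
      ultimately have "Poly_Mapping.lookup h' w > 0"
        unfolding w M(1) by (simp add: lookup_add)
      then obtain s where "h' = Poly_Mapping.single w 1 + s" by (rule split_off_variable)
      then have "t + Poly_Mapping.single w 1 = (g + s) + Poly_Mapping.single w 1"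
        using w by (simp add: algebra_simps)
      then have t_eq: "t = g + s" by (rule add_right_imp_eq)
      \<comment> \<open>Here all \<open>k + 1\<close> generators divide \<open>t\<close>, and an arbitrary one is discarded.\<close>
      from M(3) obtain a where "a \<in># M" by (metis nat.distinct(1) size_empty multiset_nonemptyE)
      then obtain N where N: "M = add_mset a N" "\<Sum>\<^sub># N \<in> fold_sums k A"
        using removal by blast
      have "t = \<Sum>\<^sub># N + (a + s)"
        using t_eq M(1) N(1) by (simp add: algebra_simps)
      with N(2) show ?thesis by blast
    qed
  qed
qed

lemma strongly_superficial_monomial_ideal:
  fixes A :: "('v \<Rightarrow>\<^sub>0 nat) set" and v w :: 'v
  defines "m \<equiv> Poly_Mapping.single v 1 + Poly_Mapping.single w 1"
  assumes m: "m \<in> A" "Poly_Mapping.keys m \<subseteq> V"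
    and gens: "\<And>a. a \<in> A \<Longrightarrow> Poly_Mapping.lookup a v > 0 \<Longrightarrow> \<exists>s. a = m + s"
  shows "strongly_superficial_deg1 (polynomial_ring V)
    (monomial_ideal V A :: (('v \<Rightarrow>\<^sub>0 nat) \<Rightarrow>\<^sub>0 'k::field) set) (Poly_Mapping.single m 1)"
    (is "strongly_superficial_deg1 ?R ?I ?m")
  unfolding strongly_superficial_deg1_def
proof (intro conjI allI impI)
  show m_in: "?m \<in> ?I" using m by (rule single_in_monomial_ideal)
  fix k :: nat
  show "colon ?R (ideal_power ?R ?I (k + 1)) {?m} = ideal_power ?R ?I k"
  proof (intro equalityI subsetI)
    fix p :: "('v \<Rightarrow>\<^sub>0 nat) \<Rightarrow>\<^sub>0 'k"
    assume "p \<in> colon ?R (ideal_power ?R ?I (k + 1)) {?m}"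
    then have p: "p \<in> carrier ?R" and pm: "p * ?m \<in> monomial_ideal V (fold_sums (Suc k) A)"
      using ideal_power_monomial_ideal[of V A "Suc k"]
      by (auto simp: colon_def polynomial_ring_def)
    have "Poly_Mapping.keys t \<subseteq> V \<and> (\<exists>g\<in>fold_sums k A. \<exists>s. t = g + s)"
      if t: "t \<in> Poly_Mapping.keys p" for t
    proof
      show "Poly_Mapping.keys t \<subseteq> V" using p t by (simp add: polynomial_ring_def)
      have "t + m \<in> Poly_Mapping.keys (p * ?m)"
        using t by (simp add: in_keys_iff lookup_times_monomial)
      then obtain g h where "t + m = g + h" "g \<in> fold_sums (Suc k) A"
        using pm unfolding monomial_ideal_def by blast
      then show "\<exists>g\<in>fold_sums k A. \<exists>s. t = g + s"
        using gens unfolding m_def by (intro superficial_exponents)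
    qed
    then show "p \<in> ideal_power ?R ?I k"
      unfolding ideal_power_monomial_ideal by (simp add: monomial_ideal_def)
  next
    fix p :: "('v \<Rightarrow>\<^sub>0 nat) \<Rightarrow>\<^sub>0 'k"
    assume p: "p \<in> ideal_power ?R ?I k"
    then have "p \<otimes>\<^bsub>?R\<^esub> ?m \<in> ideal_power ?R ?I (k + 1)"
      using ideal_prod.prod[OF p m_in, of ?R] by (simp add: ideal_power_Suc)
    moreover have "p \<in> carrier ?R"
      using p monomial_ideal_subset_carrier by (auto simp: ideal_power_monomial_ideal)
    ultimately show "p \<in> colon ?R (ideal_power ?R ?I (k + 1)) {?m}"
      by (simp add: colon_def)
  qed
qed

lemma strong_persistence_if_strongly_superficial:
  assumes "strongly_superficial_deg1 R I m"
  shows "strong_persistence R I"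
  unfolding strong_persistence_def
proof (intro allI impI)
  fix k :: nat assume "k \<ge> 1"
  with assms have m: "m \<in> I" and eq: "colon R (ideal_power R I (k + 1)) {m} = ideal_power R I k"
    by (auto simp: strongly_superficial_deg1_def)
  show "colon R (ideal_power R I (k + 1)) I = ideal_power R I k"
  proof
    show "colon R (ideal_power R I (k + 1)) I \<subseteq> ideal_power R I k"
      unfolding eq[symmetric] using m by (auto simp: colon_def)
    have "ideal_power R I k \<subseteq> carrier R"
      unfolding eq[symmetric] by (auto simp: colon_def)
    then show "ideal_power R I k \<subseteq> colon R (ideal_power R I (k + 1)) I"
      by (auto simp: colon_def ideal_power_Suc intro: ideal_prod.prod)
  qed
qed

section \<open>Closed neighbourhood ideals\<close>

definition nbhd_exponent :: "'v pair_pre_digraph \<Rightarrow> 'v \<Rightarrow> ('v \<Rightarrow>\<^sub>0 nat)" where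
  "nbhd_exponent G y = (\<Sum>z\<in>closed_nbhd G y. Poly_Mapping.single z 1)"

lemma prod_var: "(\<Prod>z\<in>S. var z) = Poly_Mapping.single (\<Sum>z\<in>S. Poly_Mapping.single z 1) 1"
  by (induction S rule: infinite_finite_induct) (auto simp: var_def mult_single)

lemma CNI_eq_monomial_ideal:
  "CNI G = (monomial_ideal (pverts G) (nbhd_exponent G ` pverts G)
    :: (('v \<Rightarrow>\<^sub>0 nat) \<Rightarrow>\<^sub>0 'k::field) set)"
proof -
  have "{\<Prod>z\<in>closed_nbhd G y. var z | y. y \<in> pverts G}
      = (\<lambda>a. Poly_Mapping.single a (1 :: 'k)) ` nbhd_exponent G ` pverts G"
    by (auto simp: prod_var nbhd_exponent_def)
  moreover have "Poly_Mapping.keys (nbhd_exponent G y) \<subseteq> pverts G" if "y \<in> pverts G" for y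
    using that Poly_Mapping.keys_sum[of "\<lambda>z. Poly_Mapping.single z (1::nat)" "closed_nbhd G y"]
    by (auto simp: nbhd_exponent_def closed_nbhd_def)
  ultimately show ?thesis
    unfolding CNI_def by (simp only:) (intro genideal_monomials, auto)
qed

lemma lookup_nbhd_exponent:
  assumes "finite (pverts G)"
  shows "Poly_Mapping.lookup (nbhd_exponent G y) z = (if z \<in> closed_nbhd G y then 1 else 0)"
proof -
  have "finite (closed_nbhd G y)" using assms by (simp add: closed_nbhd_def)
  then show ?thesis by (simp add: nbhd_exponent_def lookup_sum lookup_single when_def)
qed

lemma (in pair_graph) leaf_neighbourE:
  assumes "out_degree (with_proj G) v = 1"
  obtains w where "w \<in> pverts G" "v \<noteq> w" "closed_nbhd G v = {v, w}"
    "\<And>y. (y, v) \<in> parcs G \<longleftrightarrow> y = w"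
proof -
  have "card {e \<in> parcs G. fst e = v} = 1"
    using assms by (simp add: out_degree_def out_arcs_def)
  then obtain e where e: "{e \<in> parcs G. fst e = v} = {e}"
    by (rule card_1_singletonE)
  then have "fst e = v" by (metis (mono_tags, lifting) mem_Collect_eq singletonI)
  then obtain w where "e = (v, w)" by (cases e) auto
  have out: "(v, y) \<in> parcs G \<longleftrightarrow> y = w" for y
  proof -
    have "(v, y) \<in> parcs G \<longleftrightarrow> (v, y) \<in> {e \<in> parcs G. fst e = v}" by simp
    also have "\<dots> \<longleftrightarrow> y = w" unfolding e \<open>e = (v, w)\<close> by simp
    finally show ?thesis .
  qed
  then have "w \<in> pverts G" by (auto dest: in_arcsD2)
  moreover have "v \<noteq> w" using out[of w] by (auto dest: no_loops')
  moreover have "closed_nbhd G v = {v, w}"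
    using out \<open>w \<in> pverts G\<close> by (auto simp: closed_nbhd_def)
  moreover have "(y, v) \<in> parcs G \<longleftrightarrow> y = w" for y
    using out pair_sym_arcs by (auto simp: symmetric_def dest: symD)
  ultimately show ?thesis using that by blast
qed

theorem theorem3p1:
  fixes G :: "'v pair_pre_digraph"
  assumes "pair_graph G"
    and "\<exists>v \<in> pverts G. out_degree (with_proj G) v = 1"
  shows "(\<exists>m. strongly_superficial_deg1 (polynomial_ring (pverts G))
              (CNI G :: (('v \<Rightarrow>\<^sub>0 nat) \<Rightarrow>\<^sub>0 'k::field) set) m)
       \<and> strong_persistence (polynomial_ring (pverts G))
              (CNI G :: (('v \<Rightarrow>\<^sub>0 nat) \<Rightarrow>\<^sub>0 'k) set)"
proof -
  interpret pair_graph G by fact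
  obtain v where v: "v \<in> pverts G" "out_degree (with_proj G) v = 1" using assms(2) by blast
  obtain w where w: "w \<in> pverts G" "v \<noteq> w" and nv: "closed_nbhd G v = {v, w}"
      and into_v: "\<And>y. (y, v) \<in> parcs G \<longleftrightarrow> y = w"
    using leaf_neighbourE[OF v(2)] by blast
  let ?m = "Poly_Mapping.single v (1::nat) + Poly_Mapping.single w 1"
  have m: "nbhd_exponent G v = ?m"
    using w(2) by (simp add: nbhd_exponent_def nv)
  have "\<exists>s. a = ?m + s"
    if a: "a \<in> nbhd_exponent G ` pverts G" "Poly_Mapping.lookup a v > 0" for a
  proof -
    obtain y where y: "a = nbhd_exponent G y" "y \<in> pverts G" using a(1) by blast
    have "v \<in> closed_nbhd G y"
      using a(2) by (simp add: y lookup_nbhd_exponent pair_finite_verts split: if_splits)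
    then have "y = v \<or> y = w" using into_v by (auto simp: closed_nbhd_def)
    then have "v \<in> closed_nbhd G y" "w \<in> closed_nbhd G y"
      using nv v(1) into_v by (auto simp: closed_nbhd_def)
    then have "a = ?m + (a - ?m)"
      using w(2) by (intro poly_mapping_eqI)
        (auto simp: y lookup_nbhd_exponent pair_finite_verts lookup_add lookup_minus
          lookup_single when_def)
    then show ?thesis ..
  qed
  moreover have "?m \<in> nbhd_exponent G ` pverts G" using m v(1) by force
  moreover have "Poly_Mapping.keys ?m \<subseteq> pverts G" using v(1) w(1) by (simp add: keys_plus_nat)
  ultimately have "strongly_superficial_deg1 (polynomial_ring (pverts G))
      (CNI G :: (('v \<Rightarrow>\<^sub>0 nat) \<Rightarrow>\<^sub>0 'k) set) (Poly_Mapping.single ?m 1)"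
    unfolding CNI_eq_monomial_ideal by (intro strongly_superficial_monomial_ideal)
  then show ?thesis
    using strong_persistence_if_strongly_superficial by (intro conjI exI)
qed

end
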